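(* Let $m\ge 1$, let $C_m$ be the cyclic biquandle of order $m$, and let $n\ge 1$. Then the torsion subgroup of $H^n_{YB}(C_m;\mathbb{Z})$ is annihilated by $m$ if $m$ is odd, and by $2m$ if $m$ is even.
   Context: The cyclic biquandle $C_m$ of order $m$ is the set $\mathbb{Z}/m\mathbb{Z}$ with the map $R(a,b)=(b+1,a-1)$. Its set-theoretic Yang-Baxter chain complex: for $n\ge 1$, $C_n^{YB}(C_m)$ is the free abelian group with basis $(C_m)^n$, and $C_n^{YB}(C_m)=0$ for $n\le 0$. The boundary is $\partial_n=\sum_{i=1}^n(-1)^{i-1}(d^l_{i,n}-d^r_{i,n})$ for $n\ge 2$ (and $\partial_n=0$ for $n\le 1$), where on basis elements $$d^l_{i,n}(x_1,\ldots,x_n)=(x_1-1,\ldots,x_{i-1}-1,x_{i+1},\ldots,x_n),$$ $$d^r_{i,n}(x_1,\ldots,x_n)=(x_1,\ldots,x_{i-1},x_{i+1}+1,\ldots,x_n+1).$$ For an abelian group $A$, $C^n_{YB}(C_m;A)=\mathrm{Hom}(C_n^{YB}(C_m),A)$ with $\delta^n f=f\circ\partial_{n+1}$, and $H^n_{YB}(C_m;A)$ is the cohomology of this cochain complex. *)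

theory Defs
  imports "HOL-Algebra.Algebra"
begin

text \<open>The set \<open>\<int>/m\<int>\<close> is \<^term>\<open>carrier (integer_mod_group m)\<close>, i.e. the residues
  \<open>{0..<int m}\<close> for \<open>m \<ge> 1\<close>; the two maps below are \<open>x \<mapsto> x + 1\<close> and \<open>x \<mapsto> x - 1\<close> on it.\<close>

definition cyc_up :: "nat \<Rightarrow> int \<Rightarrow> int" where
  "cyc_up m x = (x + 1) mod int m"

definition cyc_down :: "nat \<Rightarrow> int \<Rightarrow> int" where
  "cyc_down m x = (x - 1) mod int m"

definition cyc_R :: "nat \<Rightarrow> int \<times> int \<Rightarrow> int \<times> int" where
  "cyc_R m = (\<lambda>(a, b). (cyc_up m b, cyc_down m a))"

lemma cyc_R_closed:
  assumes "m \<ge> 1"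
  shows "cyc_R m ` (carrier (integer_mod_group m) \<times> carrier (integer_mod_group m))
           \<subseteq> carrier (integer_mod_group m) \<times> carrier (integer_mod_group m)"
  using assms by (auto simp: cyc_R_def cyc_up_def cyc_down_def carrier_integer_mod_group)

text \<open>Tuples \<open>(x\<^sub>1, \<dots>, x\<^sub>n)\<close> are lists. Degrees are natural numbers, the groups in negative degrees
  being zero. In degree \<open>0\<close> the basis is empty (the empty tuple is excluded), so that the chain
  group vanishes there as well.\<close>

definition yb_basis :: "nat \<Rightarrow> nat \<Rightarrow> int list set" where
  "yb_basis m n = (if n = 0 then {}
     else {xs. length xs = n \<and> set xs \<subseteq> carrier (integer_mod_group m)})"

definition yb_chain :: "nat \<Rightarrow> nat \<Rightarrow> (int list \<Rightarrow>\<^sub>0 int) monoid" where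
  "yb_chain m n = free_Abelian_group (yb_basis m n)"

text \<open>The face maps on basis elements; the index \<open>i\<close> starts at \<open>1\<close>.\<close>

definition yb_dl :: "nat \<Rightarrow> nat \<Rightarrow> int list \<Rightarrow> int list" where
  "yb_dl m i xs = map (cyc_down m) (take (i - 1) xs) @ drop i xs"

definition yb_dr :: "nat \<Rightarrow> nat \<Rightarrow> int list \<Rightarrow> int list" where
  "yb_dr m i xs = take (i - 1) xs @ map (cyc_up m) (drop i xs)"

definition yb_boundary :: "nat \<Rightarrow> nat \<Rightarrow> (int list \<Rightarrow>\<^sub>0 int) \<Rightarrow> (int list \<Rightarrow>\<^sub>0 int)" where
  "yb_boundary m n c =
     (if n \<le> 1 then 0
      else frag_extend
        (\<lambda>xs. \<Sum>i = 1..n. frag_cmul ((-1) ^ (i - 1)) (frag_of (yb_dl m i xs) - frag_of (yb_dr m i xs))) c)"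

text \<open>\<open>Hom(G, A)\<close> with pointwise operations. Homomorphisms are taken to be extensional
  (\<open>undefined\<close> outside \<open>carrier G\<close>), since \<^const>\<open>hom\<close> alone does not determine a function
  off the carrier.\<close>

definition Hom_group :: "('a, 'c) monoid_scheme \<Rightarrow> ('b, 'd) monoid_scheme \<Rightarrow> ('a \<Rightarrow> 'b) monoid" where
  "Hom_group G A =
     \<lparr>carrier = hom G A \<inter> extensional (carrier G),
      monoid.mult = (\<lambda>f g. \<lambda>x\<in>carrier G. f x \<otimes>\<^bsub>A\<^esub> g x),
      one = (\<lambda>x\<in>carrier G. \<one>\<^bsub>A\<^esub>)\<rparr>"

lemma comm_group_Hom_group:
  assumes "group G" "comm_group A"
  shows "comm_group (Hom_group G A)"
proof -
  interpret G: group G by fact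
  interpret A: comm_group A by fact
  show ?thesis
  proof (rule comm_groupI)
    fix f assume f: "f \<in> carrier (Hom_group G A)"
    let ?g = "\<lambda>x\<in>carrier G. inv\<^bsub>A\<^esub> f x"
    have fc: "f x \<in> carrier A" if "x \<in> carrier G" for x
      using f that by (auto simp: Hom_group_def hom_def)
    have "?g \<in> carrier (Hom_group G A)"
      using f fc by (auto simp: Hom_group_def hom_def A.inv_mult)
    moreover have "?g \<otimes>\<^bsub>Hom_group G A\<^esub> f = \<one>\<^bsub>Hom_group G A\<^esub>"
      using fc by (auto simp: Hom_group_def fun_eq_iff)
    ultimately show "\<exists>g \<in> carrier (Hom_group G A). g \<otimes>\<^bsub>Hom_group G A\<^esub> f = \<one>\<^bsub>Hom_group G A\<^esub>"
      by blast
  qed (auto simp: Hom_group_def hom_def fun_eq_iff Pi_iff A.m_ac extensional_def)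
qed

definition yb_cochain ::
    "nat \<Rightarrow> ('b, 'd) monoid_scheme \<Rightarrow> nat \<Rightarrow> ((int list \<Rightarrow>\<^sub>0 int) \<Rightarrow> 'b) monoid" where
  "yb_cochain m A n = Hom_group (yb_chain m n) A"

definition yb_coboundary ::
    "nat \<Rightarrow> nat \<Rightarrow> ((int list \<Rightarrow>\<^sub>0 int) \<Rightarrow> 'b) \<Rightarrow> ((int list \<Rightarrow>\<^sub>0 int) \<Rightarrow> 'b)" where
  "yb_coboundary m n f = compose (carrier (yb_chain m (Suc n))) f (yb_boundary m (Suc n))"

definition yb_cocycles ::
    "nat \<Rightarrow> ('b, 'd) monoid_scheme \<Rightarrow> nat \<Rightarrow> ((int list \<Rightarrow>\<^sub>0 int) \<Rightarrow> 'b) set" where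
  "yb_cocycles m A n = kernel (yb_cochain m A n) (yb_cochain m A (Suc n)) (yb_coboundary m n)"

text \<open>In degree \<open>0\<close> the incoming coboundary map starts at the zero group.\<close>

definition yb_coboundaries ::
    "nat \<Rightarrow> ('b, 'd) monoid_scheme \<Rightarrow> nat \<Rightarrow> ((int list \<Rightarrow>\<^sub>0 int) \<Rightarrow> 'b) set" where
  "yb_coboundaries m A n =
     (if n = 0 then {\<one>\<^bsub>yb_cochain m A 0\<^esub>}
      else yb_coboundary m (n - 1) ` carrier (yb_cochain m A (n - 1)))"

definition yb_cohomology ::
    "nat \<Rightarrow> ('b, 'd) monoid_scheme \<Rightarrow> nat \<Rightarrow> ((int list \<Rightarrow>\<^sub>0 int) \<Rightarrow> 'b) set monoid" where
  "yb_cohomology m A n =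
     (yb_cochain m A n)\<lparr>carrier := yb_cocycles m A n\<rparr> Mod yb_coboundaries m A n"

definition torsion_subgroup :: "('a, 'b) monoid_scheme \<Rightarrow> 'a set" where
  "torsion_subgroup G = {x \<in> carrier G. \<exists>k::nat. k > 0 \<and> x [^]\<^bsub>G\<^esub> k = \<one>\<^bsub>G\<^esub>}"

text \<open>Multiplicative notation for the group: \<open>x [^] k\<close> is \<open>k \<cdot> x\<close> for an additive group.\<close>

definition annihilated_by :: "('a, 'b) monoid_scheme \<Rightarrow> 'a set \<Rightarrow> nat \<Rightarrow> bool" where
  "annihilated_by G T k \<longleftrightarrow> (\<forall>x\<in>T. x [^]\<^bsub>G\<^esub> k = \<one>\<^bsub>G\<^esub>)"

end

theory Submission
  imports Defs
begin

text \<open>Shifting all coordinates by \<open>1\<close> defines an operator \<open>T\<close> with \<open>T\<^sup>m = 1\<close> that commutes with the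
  faces, and the \<open>i\<close>-th right face is \<open>T\<close> applied to the \<open>i\<close>-th left face. Hence the coboundary is
  \<open>(1 - T) D\<close>, where \<open>D\<close> is the alternating sum of the left faces, and \<open>D f = 0\<close> implies \<open>f = D h\<close> for some
  \<open>h\<close> in degrees \<open>n \<ge> 2\<close>; in degree \<open>1\<close> there are no coboundaries and hence no torsion. Put
  \<open>N = 1 + T + \<dots> + T\<^sup>m\<^sup>-\<^sup>1\<close>. If \<open>f\<close> is a cocycle and \<open>k f = (1 - T) D g\<close>, then \<open>N f = 0\<close>, so the
  \<open>T\<close>-invariant \<open>D f\<close> satisfies \<open>m D f = D N f = 0\<close>; thus \<open>f = D h\<close> for some \<open>h\<close>. Writing
  \<open>m - N = (1 - T) Q\<close> gives \<open>m f = m f - N f = (1 - T) D Q h\<close>, a coboundary. So \<open>m\<close> annihilates the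
  torsion for every parity of \<open>m\<close>, and a fortiori \<open>2 m\<close> does.\<close>

section \<open>Residue tuples, the shift and the face maps\<close>

definition tuples :: "nat \<Rightarrow> nat \<Rightarrow> int list set" where
  "tuples m n = {xs. length xs = n \<and> set xs \<subseteq> {0..<int m}}"

text \<open>This is the operator \<open>D\<close>. It acts on arbitrary integer functions on lists,
  so that the combinatorics involves no homomorphism or extensionality conditions.\<close>

definition left_sum :: "nat \<Rightarrow> nat \<Rightarrow> (int list \<Rightarrow> int) \<Rightarrow> int list \<Rightarrow> int" where
  "left_sum m n \<phi> xs = (\<Sum>i = 1..n. (-1) ^ (i - 1) * \<phi> (yb_dl m i xs))"

abbreviation shift :: "nat \<Rightarrow> int list \<Rightarrow> int list" where
  "shift m \<equiv> map (cyc_up m)"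

lemma cyc_up_down [simp]: "cyc_up m (cyc_down m x) = x mod int m"
  by (simp add: cyc_up_def cyc_down_def mod_simps)

lemma cyc_down_up [simp]: "cyc_down m (cyc_up m x) = x mod int m"
  by (simp add: cyc_up_def cyc_down_def mod_simps)

lemma yb_dl_shift: "yb_dl m i (shift m xs) = shift m (yb_dl m i xs)"
  by (auto simp: yb_dl_def take_map drop_map)

lemma yb_dl_shift_funpow: "yb_dl m i ((shift m ^^ j) xs) = (shift m ^^ j) (yb_dl m i xs)"
  by (induction j) (auto simp: yb_dl_shift)

text \<open>Raising undoes the lowering of the entries before position \<open>i\<close> up to
  reduction modulo \<open>m\<close>, which is the identity on residues.\<close>

lemma shift_yb_dl:
  assumes "set xs \<subseteq> {0..<int m}"
  shows "shift m (yb_dl m i xs) = yb_dr m i xs"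
proof -
  have "x mod int m = x" if "x \<in> set (take (i - 1) xs)" for x
    using that assms by (auto dest!: in_set_takeD)
  then show ?thesis
    by (auto simp: yb_dl_def yb_dr_def intro: map_idI)
qed

lemma yb_dl_tuples:
  assumes "m \<ge> 1" "i \<in> {1..Suc n}" "xs \<in> tuples m (Suc n)"
  shows "yb_dl m i xs \<in> tuples m n"
  using assms by (auto simp: yb_dl_def tuples_def cyc_down_def dest!: in_set_takeD in_set_dropD)

lemma shift_tuples:
  assumes "m \<ge> 1" "xs \<in> tuples m n"
  shows "shift m xs \<in> tuples m n"
  using assms by (auto simp: tuples_def cyc_up_def)

lemma shift_funpow_tuples:
  assumes "m \<ge> 1" "xs \<in> tuples m n"
  shows "(shift m ^^ j) xs \<in> tuples m n"
  using assms by (induction j) (auto intro: shift_tuples)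

lemma shift_funpow:
  assumes "xs \<in> tuples m n"
  shows "(shift m ^^ j) xs = map (\<lambda>x. (x + int j) mod int m) xs"
proof (induction j)
  case 0
  show ?case using assms by (auto simp: tuples_def intro!: map_idI[symmetric])
next
  case (Suc j)
  then show ?case by (auto simp: cyc_up_def mod_simps algebra_simps)
qed

lemma shift_funpow_order:
  assumes "xs \<in> tuples m n"
  shows "(shift m ^^ m) xs = xs"
  using assms by (subst shift_funpow[OF assms]) (auto simp: tuples_def intro!: map_idI)

section \<open>Shift-equivariance and linearity of \<open>left_sum\<close>\<close>

lemma left_sum_shift_funpow:
  "left_sum m n \<phi> ((shift m ^^ j) xs) = left_sum m n (\<lambda>ys. \<phi> ((shift m ^^ j) ys)) xs"
  by (simp add: left_sum_def yb_dl_shift_funpow)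

lemma left_sum_shift:
  "left_sum m n \<phi> (shift m xs) = left_sum m n (\<lambda>ys. \<phi> (shift m ys)) xs"
  by (simp add: left_sum_def yb_dl_shift)

lemma left_sum_sum:
  "left_sum m n (\<lambda>ys. \<Sum>j\<in>J. \<phi> j ys) xs = (\<Sum>j\<in>J. left_sum m n (\<phi> j) xs)"
  unfolding left_sum_def sum_distrib_left by (rule sum.swap)

lemma left_sum_diff:
  "left_sum m n (\<lambda>ys. \<phi> ys - \<psi> ys) xs = left_sum m n \<phi> xs - left_sum m n \<psi> xs"
  by (simp add: left_sum_def right_diff_distrib sum_subtractf)

lemma left_sum_cmult: "left_sum m n (\<lambda>ys. c * \<phi> ys) xs = c * left_sum m n \<phi> xs"
  by (simp add: left_sum_def sum_distrib_left mult.left_commute)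

lemma left_sum_cong:
  assumes "m \<ge> 1" "xs \<in> tuples m (Suc n)" "\<And>ys. ys \<in> tuples m n \<Longrightarrow> \<phi> ys = \<psi> ys"
  shows "left_sum m (Suc n) \<phi> xs = left_sum m (Suc n) \<psi> xs"
  unfolding left_sum_def using assms yb_dl_tuples by (auto intro!: sum.cong)

text \<open>Prepending a coordinate is a contracting homotopy for the left faces. The faces after the
  first lower the new coordinate, whence the shifted values \<open>1\<close> and \<open>0\<close>.\<close>

lemma left_sum_Cons:
  "left_sum m (Suc n) \<phi> (cyc_up m 0 # xs) = \<phi> xs - left_sum m n (\<lambda>ys. \<phi> (0 # ys)) xs"
proof -
  have "left_sum m (Suc n) \<phi> (cyc_up m 0 # xs) =
      \<phi> xs + (\<Sum>i = 1..n. (-1) ^ i * \<phi> (yb_dl m (Suc i) (cyc_up m 0 # xs)))"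
    unfolding left_sum_def
    by (subst sum.atLeast_Suc_atMost) (simp_all add: sum.shift_bounds_cl_Suc_ivl yb_dl_def del: sum.cl_ivl_Suc)
  also have "(\<Sum>i = 1..n. (-1) ^ i * \<phi> (yb_dl m (Suc i) (cyc_up m 0 # xs))) =
      (\<Sum>i = 1..n. - ((-1) ^ (i - 1) * \<phi> (0 # yb_dl m i xs)))"
  proof (rule sum.cong)
    fix i assume "i \<in> {1..n}"
    \<comment> \<open>The successor form shows that the new head lies in the prefix lowered by
      \<open>yb_dl\<close>, and that the sign changes.\<close>
    then obtain j where "i = Suc j" by (cases i) auto
    then show "(-1) ^ i * \<phi> (yb_dl m (Suc i) (cyc_up m 0 # xs)) =
        - ((-1) ^ (i - 1) * \<phi> (0 # yb_dl m i xs))"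
      by (simp add: yb_dl_def)
  qed simp
  finally show ?thesis by (simp add: left_sum_def sum_negf)
qed

section \<open>The torsion argument for functions on tuples\<close>

text \<open>Here \<open>\<psi> = Q \<eta>\<close>, where \<open>Q\<close> is the sum of
  \<open>1 + T + ... + T\<^sup>i\<^sup>-\<^sup>1\<close> over \<open>i < m\<close>. Each summand
  times \<open>1 - T\<close> telescopes to \<open>1 - T\<^sup>i\<close>, whence
  \<open>(1 - T) Q = m - N\<close>; then \<open>D\<close> is applied, which commutes with
  \<open>T\<close>.\<close>

lemma left_sum_shift_iterated_sum:
  fixes m :: nat and \<eta> :: "int list \<Rightarrow> int"
  defines "\<psi> \<equiv> \<lambda>ys. \<Sum>i<m. \<Sum>j<i. \<eta> ((shift m ^^ j) ys)"
  shows "left_sum m n \<psi> xs - left_sum m n \<psi> (shift m xs) =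
    int m * left_sum m n \<eta> xs - (\<Sum>j<m. left_sum m n \<eta> ((shift m ^^ j) xs))"
proof -
  have "\<psi> ys - \<psi> (shift m ys) = int m * \<eta> ys - (\<Sum>i<m. \<eta> ((shift m ^^ i) ys))" for ys
  proof -
    have "(\<Sum>j<i. \<eta> ((shift m ^^ j) ys)) - (\<Sum>j<i. \<eta> ((shift m ^^ j) (shift m ys)))
        = \<eta> ys - \<eta> ((shift m ^^ i) ys)" for i
      by (induction i) (auto simp: funpow_swap1)
    then show ?thesis by (simp add: \<psi>_def flip: sum_subtractf) (simp add: sum_subtractf)
  qed
  then show ?thesis
    by (simp add: left_sum_shift left_sum_shift_funpow left_sum_cmult left_sum_sum
        flip: left_sum_diff)
      (simp add: left_sum_diff left_sum_cmult left_sum_sum)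
qed

lemma torsion_left_sum:
  fixes \<phi> \<gamma> :: "int list \<Rightarrow> int"
  assumes m: "m \<ge> 1" and k: "k > 0"
    and torsion: "\<And>xs. xs \<in> tuples m (Suc n) \<Longrightarrow>
      int k * \<phi> xs = left_sum m (Suc n) \<gamma> xs - left_sum m (Suc n) \<gamma> (shift m xs)"
    and cocycle: "\<And>xs. xs \<in> tuples m (Suc (Suc n)) \<Longrightarrow>
      left_sum m (Suc (Suc n)) \<phi> xs = left_sum m (Suc (Suc n)) \<phi> (shift m xs)"
  shows "\<exists>\<psi>. \<forall>xs\<in>tuples m (Suc n).
      int m * \<phi> xs = left_sum m (Suc n) \<psi> xs - left_sum m (Suc n) \<psi> (shift m xs)"
proof -
  have norm_0: "(\<Sum>j<m. \<phi> ((shift m ^^ j) xs)) = 0" if xs: "xs \<in> tuples m (Suc n)" for xs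
  proof -
    \<comment> \<open>The differences telescope along the orbit of \<open>xs\<close>, which closes
      up after \<open>m\<close> shifts. The positive factor \<open>k\<close> cancels in the
      integers.\<close>
    have "int k * (\<Sum>j<m. \<phi> ((shift m ^^ j) xs)) =
        (\<Sum>j<m. left_sum m (Suc n) \<gamma> ((shift m ^^ j) xs) - left_sum m (Suc n) \<gamma> ((shift m ^^ Suc j) xs))"
      using torsion[OF shift_funpow_tuples[OF m xs]] by (simp add: sum_distrib_left)
    also have "\<dots> = left_sum m (Suc n) \<gamma> xs - left_sum m (Suc n) \<gamma> ((shift m ^^ m) xs)"
      by (subst sum_lessThan_telescope') simp
    also have "\<dots> = 0"
      by (simp add: shift_funpow_order[OF xs])
    finally show ?thesis using k by simp
  qed
  have closed: "left_sum m (Suc (Suc n)) \<phi> xs = 0" if xs: "xs \<in> tuples m (Suc (Suc n))" for xs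
  proof -
    have "left_sum m (Suc (Suc n)) \<phi> ((shift m ^^ j) xs) = left_sum m (Suc (Suc n)) \<phi> xs" for j
      by (induction j) (use cocycle[OF shift_funpow_tuples[OF m xs]] in auto)
    then have "int m * left_sum m (Suc (Suc n)) \<phi> xs =
        (\<Sum>j<m. left_sum m (Suc (Suc n)) \<phi> ((shift m ^^ j) xs))"
      by simp
    also have "\<dots> = left_sum m (Suc (Suc n)) (\<lambda>ys. \<Sum>j<m. \<phi> ((shift m ^^ j) ys)) xs"
      by (simp add: left_sum_shift_funpow left_sum_sum)
    \<comment> \<open>The left faces of \<open>xs\<close> are tuples one entry shorter, where
      \<open>norm_0\<close> applies.\<close>
    also have "\<dots> = left_sum m (Suc (Suc n)) (\<lambda>ys. 0) xs"
      by (rule left_sum_cong[OF m xs norm_0])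
    also have "\<dots> = 0"
      by (simp add: left_sum_def)
    finally show ?thesis using m by simp
  qed
  \<comment> \<open>This is the contracting homotopy applied to \<open>\<phi>\<close>: closedness at
    the tuple with head \<open>cyc_up m 0\<close> turns into exactness at \<open>xs\<close>.\<close>
  define \<eta> where "\<eta> = (\<lambda>ys. \<phi> (0 # ys))"
  have exact: "\<phi> xs = left_sum m (Suc n) \<eta> xs" if xs: "xs \<in> tuples m (Suc n)" for xs
  proof -
    have "cyc_up m 0 # xs \<in> tuples m (Suc (Suc n))"
      using xs m by (auto simp: tuples_def cyc_up_def)
    from closed[OF this] show ?thesis
      by (simp add: left_sum_Cons \<eta>_def)
  qed
  show ?thesis
  proof (intro exI ballI)
    fix xs assume xs: "xs \<in> tuples m (Suc n)"
    let ?\<psi> = "\<lambda>ys. \<Sum>i<m. \<Sum>j<i. \<eta> ((shift m ^^ j) ys)"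
    \<comment> \<open>By \<open>exact\<close>, the sum subtracted in the iterated-sum identity is
      the norm of \<open>\<phi>\<close> at \<open>xs\<close>, which vanishes.\<close>
    show "int m * \<phi> xs = left_sum m (Suc n) ?\<psi> xs - left_sum m (Suc n) ?\<psi> (shift m xs)"
      using left_sum_shift_iterated_sum[of m "Suc n" \<eta> xs] norm_0[OF xs] exact[OF xs]
        exact[OF shift_funpow_tuples[OF m xs]]
      by simp
  qed
qed

section \<open>Torsion in a subquotient of a commutative group\<close>

lemma (in comm_group) annihilated_by_torsion_Mod:
  assumes Z: "Z \<subseteq> carrier G" and B: "subgroup B G"
    and l: "\<And>z k::nat. z \<in> Z \<Longrightarrow> k > 0 \<Longrightarrow> z [^] k \<in> B \<Longrightarrow> z [^] l \<in> B"
  shows "annihilated_by (G\<lparr>carrier := Z\<rparr> Mod B) (torsion_subgroup (G\<lparr>carrier := Z\<rparr> Mod B)) l"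
proof -
  interpret B: normal B G
    by (rule subgroup_imp_normal[OF B])
  \<comment> \<open>The product and unit of a factor group do not depend on the carrier of the group
    being divided, so powers may be computed in \<open>G Mod B\<close>.\<close>
  have pow_eq: "(C [^]\<^bsub>G\<lparr>carrier := Z\<rparr> Mod B\<^esub> k) = (C [^]\<^bsub>G Mod B\<^esub> k)" for C and k :: nat
    by (simp add: nat_pow_def set_mult_def)
  have coset_eq: "B #>\<^bsub>G\<lparr>carrier := Z\<rparr>\<^esub> z = B #> z" for z
    by (simp add: r_coset_def)
  have pow_iff: "(B #> z) [^]\<^bsub>G Mod B\<^esub> k = B \<longleftrightarrow> z [^] k \<in> B" if "z \<in> Z" for z and k :: nat
    using that Z B coset_join1[OF _ _ B] coset_join2[OF _ B]
    by (subst B.FactGroup_pow) (auto simp: subset_iff)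
  show ?thesis
    unfolding annihilated_by_def torsion_subgroup_def carrier_FactGroup pow_eq one_FactGroup
    using l by (clarsimp simp: coset_eq pow_iff simp del: one_FactGroup)
qed

section \<open>Homomorphisms on free abelian groups and the boundary map\<close>

lemma hom_integer_frag_diff:
  assumes g: "g \<in> hom (free_Abelian_group S) integer_group"
    and "Poly_Mapping.keys a \<subseteq> S" "Poly_Mapping.keys b \<subseteq> S"
  shows "g (a - b) = g a - g b"
proof -
  have "Poly_Mapping.keys (a - b) \<subseteq> S"
    using keys_diff[of a b] assms(2,3) by blast
  then show ?thesis
    using hom_mult[OF g, of "a - b" b] assms(3) by simp
qed

lemma hom_integer_frag_zero:
  assumes "g \<in> hom (free_Abelian_group S) integer_group"
  shows "g 0 = 0"
  using hom_one[OF assms] by simp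

lemma hom_integer_frag_eqI:
  assumes f: "f \<in> hom (free_Abelian_group S) integer_group"
    and g: "g \<in> hom (free_Abelian_group S) integer_group"
    and eq: "\<And>x. x \<in> S \<Longrightarrow> f (frag_of x) = g (frag_of x)"
    and "c \<in> carrier (free_Abelian_group S)"
  shows "f c = g c"
proof (rule free_Abelian_group_induct[where P = "\<lambda>c. f c = g c"])
  show "Poly_Mapping.keys c \<subseteq> S" using assms(4) by simp
qed (simp_all add: hom_integer_frag_zero[OF f] hom_integer_frag_zero[OF g]
    hom_integer_frag_diff[OF f] hom_integer_frag_diff[OF g] eq)

text \<open>The successor matters: \<open>tuples m 0\<close> contains \<open>[]\<close>, whereas
  \<open>yb_basis m 0\<close> is empty.\<close>

lemma yb_basis_Suc: "m \<ge> 1 \<Longrightarrow> yb_basis m (Suc n) = tuples m (Suc n)"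
  by (auto simp: yb_basis_def tuples_def carrier_integer_mod_group)

lemma yb_boundary_hom:
  assumes m: "m \<ge> 1"
  shows "yb_boundary m (Suc n) \<in> hom (yb_chain m (Suc n)) (yb_chain m n)"
proof (cases n)
  case 0
  then show ?thesis by (auto simp: hom_def yb_boundary_def yb_chain_def)
next
  case (Suc p)
  let ?b = "\<lambda>xs. \<Sum>i = 1..Suc n. frag_cmul ((-1) ^ (i - 1))
    (frag_of (yb_dl m i xs) - frag_of (yb_dr m i xs))"
  have b: "Poly_Mapping.keys (?b xs) \<subseteq> tuples m n" if xs: "xs \<in> tuples m (Suc n)" for xs
  proof -
    \<comment> \<open>Right faces are handled as shifts of left faces.\<close>
    have "yb_dl m i xs \<in> tuples m n" "yb_dr m i xs \<in> tuples m n" if "i \<in> {1..Suc n}" for i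
      using yb_dl_tuples[OF m that xs] shift_tuples[OF m yb_dl_tuples[OF m that xs]]
        shift_yb_dl[of xs m i] xs
      by (auto simp: tuples_def simp flip: shift_yb_dl)
    then have "Poly_Mapping.keys (frag_cmul ((-1) ^ (i - 1))
        (frag_of (yb_dl m i xs) - frag_of (yb_dr m i xs))) \<subseteq> tuples m n" if "i \<in> {1..Suc n}" for i
      using that keys_cmul keys_diff[of "frag_of (yb_dl m i xs)" "frag_of (yb_dr m i xs)"]
      by (fastforce simp: keys_frag_of)
    then show ?thesis
      using sum_closed_free_Abelian_group[of "{1..Suc n}" _ "tuples m n"]
      by (simp del: sum.cl_ivl_Suc)
  qed
  have "Poly_Mapping.keys (frag_extend ?b c) \<subseteq> tuples m n"
    if "Poly_Mapping.keys c \<subseteq> tuples m (Suc n)" for c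
    using keys_frag_extend[of ?b c] b that by blast
  then show ?thesis
    using Suc by (auto simp: hom_def yb_boundary_def yb_chain_def yb_basis_Suc[OF m] frag_extend_add
        simp del: sum.cl_ivl_Suc)
qed

lemma compose_in_hom_Hom_group:
  assumes "group G'" and h: "h \<in> hom G' G"
  shows "(\<lambda>f. compose (carrier G') f h) \<in> hom (Hom_group G A) (Hom_group G' A)"
proof -
  interpret G': group G' by fact
  show ?thesis
    using h by (auto simp: hom_def Hom_group_def compose_def Pi_iff fun_eq_iff)
qed

lemma Hom_group_integer_pow:
  assumes "f \<in> carrier (Hom_group G integer_group)"
  shows "f [^]\<^bsub>Hom_group G integer_group\<^esub> (k::nat) = (\<lambda>x\<in>carrier G. int k * f x)"
proof (induction k)
  case 0
  then show ?case by (simp add: Hom_group_def fun_eq_iff)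
next
  case (Suc k)
  then show ?case by (auto simp: Hom_group_def fun_eq_iff algebra_simps)
qed

lemma hom_frag_sum:
  assumes g: "g \<in> hom (free_Abelian_group S) integer_group"
    and c: "\<And>i. i \<in> I \<Longrightarrow> Poly_Mapping.keys (c i) \<subseteq> S" and "finite I"
  shows "g (\<Sum>i\<in>I. c i) = (\<Sum>i\<in>I. g (c i))"
  using \<open>finite I\<close> c
proof (induction I)
  case empty
  show ?case by (simp add: hom_integer_frag_zero[OF g])
next
  case (insert i I)
  have "Poly_Mapping.keys (\<Sum>i\<in>I. c i) \<subseteq> S"
    using sum_closed_free_Abelian_group[of I c S] insert.prems by simp
  then show ?case
    using insert hom_mult[OF g, of "c i" "\<Sum>i\<in>I. c i"] by simp
qed

lemma hom_frag_cmul_sign: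
  assumes g: "g \<in> hom (free_Abelian_group S) integer_group" and c: "Poly_Mapping.keys c \<subseteq> S"
  shows "g (frag_cmul ((-1) ^ k) c) = (-1) ^ k * g c"
  \<comment> \<open>For odd \<open>k\<close> the scaled element is \<open>0 - c\<close>.\<close>
  using hom_integer_frag_diff[OF g _ c, of 0] hom_integer_frag_zero[OF g]
  by (cases "even k") simp_all

section \<open>From cochains to functions on tuples and back\<close>

text \<open>Since right faces are shifted left faces, their alternating sum is
  \<open>left_sum\<close> at the shifted tuple. This is the formula \<open>(1 - T) D\<close> on
  basis elements.\<close>

lemma yb_coboundary_frag_of:
  assumes m: "m \<ge> 1" and g: "g \<in> carrier (yb_cochain m integer_group (Suc n))"
    and xs: "xs \<in> tuples m (Suc (Suc n))"
  shows "yb_coboundary m (Suc n) g (frag_of xs) =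
    left_sum m (Suc (Suc n)) (g \<circ> frag_of) xs - left_sum m (Suc (Suc n)) (g \<circ> frag_of) (shift m xs)"
proof -
  let ?S = "tuples m (Suc n)" and ?I = "{1..Suc (Suc n)}"
  let ?c = "\<lambda>i. frag_of (yb_dl m i xs) - frag_of (yb_dr m i xs)"
  have g': "g \<in> hom (free_Abelian_group ?S) integer_group"
    using g by (simp add: yb_cochain_def Hom_group_def yb_chain_def yb_basis_Suc[OF m])
  have dr: "shift m (yb_dl m i xs) = yb_dr m i xs" for i
    using xs by (intro shift_yb_dl) (simp add: tuples_def)
  have faces: "yb_dl m i xs \<in> ?S" "yb_dr m i xs \<in> ?S" if "i \<in> ?I" for i
    using yb_dl_tuples[OF m that xs] shift_tuples[OF m, of "yb_dl m i xs"] by (simp_all add: dr)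
  have c: "Poly_Mapping.keys (?c i) \<subseteq> ?S" if "i \<in> ?I" for i
    using faces[OF that] keys_diff[of "frag_of (yb_dl m i xs)" "frag_of (yb_dr m i xs)"]
    by (auto simp: keys_frag_of)
  have sc: "Poly_Mapping.keys (frag_cmul ((-1) ^ (i - 1)) (?c i)) \<subseteq> ?S" if "i \<in> ?I" for i
    using c[OF that] keys_cmul by fastforce
  have "yb_coboundary m (Suc n) g (frag_of xs) = g (\<Sum>i\<in>?I. frag_cmul ((-1) ^ (i - 1)) (?c i))"
    using xs by (simp add: yb_coboundary_def compose_def yb_chain_def yb_basis_Suc[OF m]
        yb_boundary_def del: sum.cl_ivl_Suc)
  also have "\<dots> = (\<Sum>i\<in>?I. g (frag_cmul ((-1) ^ (i - 1)) (?c i)))"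
    by (rule hom_frag_sum[OF g' sc]) auto
  also have "\<dots> = (\<Sum>i\<in>?I. (-1) ^ (i - 1) * (g (frag_of (yb_dl m i xs)) - g (frag_of (yb_dr m i xs))))"
  proof (rule sum.cong)
    fix i assume i: "i \<in> ?I"
    show "g (frag_cmul ((-1) ^ (i - 1)) (?c i)) =
        (-1) ^ (i - 1) * (g (frag_of (yb_dl m i xs)) - g (frag_of (yb_dr m i xs)))"
      using hom_frag_cmul_sign[OF g' c[OF i]] hom_integer_frag_diff[OF g'] faces[OF i]
      by (simp add: keys_frag_of)
  qed simp
  also have "\<dots> = left_sum m (Suc (Suc n)) (g \<circ> frag_of) xs
      - left_sum m (Suc (Suc n)) (g \<circ> frag_of) (shift m xs)"
    by (simp add: left_sum_def yb_dl_shift dr right_diff_distrib sum_subtractf del: sum.cl_ivl_Suc)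
  finally show ?thesis .
qed

lemma comm_group_yb_cochain: "comm_group (yb_cochain m integer_group n)"
  unfolding yb_cochain_def yb_chain_def
  by (intro comm_group_Hom_group group_free_Abelian_group abelian_integer_group)

lemma yb_coboundary_hom:
  assumes "m \<ge> 1"
  shows "yb_coboundary m n \<in> hom (yb_cochain m A n) (yb_cochain m A (Suc n))"
  using compose_in_hom_Hom_group[OF _ yb_boundary_hom[OF assms]]
  by (simp add: yb_coboundary_def[abs_def] yb_cochain_def yb_chain_def)

text \<open>Additivity determines a cochain on the carrier, extensionality outside it.\<close>

lemma yb_cochain_eqI:
  assumes m: "m \<ge> 1"
    and f: "f \<in> carrier (yb_cochain m integer_group (Suc n))"
    and g: "g \<in> carrier (yb_cochain m integer_group (Suc n))"
    and eq: "\<And>xs. xs \<in> tuples m (Suc n) \<Longrightarrow> f (frag_of xs) = g (frag_of xs)"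
  shows "f = g"
proof (rule extensionalityI)
  show "f c = g c" if "c \<in> carrier (yb_chain m (Suc n))" for c
    using f g that hom_integer_frag_eqI[of f "tuples m (Suc n)" g c] eq
    by (simp add: yb_cochain_def yb_chain_def Hom_group_def yb_basis_Suc[OF m])
qed (use f g in \<open>auto simp: yb_cochain_def Hom_group_def\<close>)

text \<open>On basis elements powers become integer multiples and coboundaries become
  \<open>(1 - T) D\<close>, which reduces the claim to \<open>torsion_left_sum\<close>.\<close>

lemma torsion_yb_cocycle:
  assumes m: "m \<ge> 1" and z: "z \<in> yb_cocycles m integer_group (Suc p)" and k: "k > 0"
    and zk: "z [^]\<^bsub>yb_cochain m integer_group (Suc p)\<^esub> (k::nat) \<in> yb_coboundaries m integer_group (Suc p)"
  shows "z [^]\<^bsub>yb_cochain m integer_group (Suc p)\<^esub> m \<in> yb_coboundaries m integer_group (Suc p)"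
proof -
  let ?C = "yb_cochain m integer_group"
  interpret C: comm_group "?C (Suc p)" by (rule comm_group_yb_cochain)
  have z_carrier: "z \<in> carrier (?C (Suc p))"
    using z by (simp add: yb_cocycles_def kernel_def)
  have pow: "(z [^]\<^bsub>?C (Suc p)\<^esub> (l::nat)) (frag_of xs) = int l * z (frag_of xs)"
    if "xs \<in> tuples m (Suc p)" for l xs
    using that Hom_group_integer_pow[of z "yb_chain m (Suc p)" l] z_carrier
    by (simp add: yb_cochain_def yb_chain_def yb_basis_Suc[OF m])
  obtain g where g: "g \<in> carrier (?C p)" and zk_eq: "z [^]\<^bsub>?C (Suc p)\<^esub> k = yb_coboundary m p g"
    using zk by (auto simp: yb_coboundaries_def)
  have cobdry_closed: "yb_coboundary m p g \<in> carrier (?C (Suc p))" if "g \<in> carrier (?C p)" for g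
    using hom_in_carrier[OF yb_coboundary_hom[OF m] that] .
  have "\<exists>g\<in>carrier (?C p). \<forall>xs\<in>tuples m (Suc p).
      int m * z (frag_of xs) = yb_coboundary m p g (frag_of xs)"
  proof (cases p)
    \<comment> \<open>The boundary out of degree 1 is zero, so all coboundaries vanish there. Hence
      \<open>k z = 0\<close> forces \<open>z\<close> to vanish on the basis, and \<open>g\<close>
      itself is a witness.\<close>
    case 0
    have "g 0 = 0"
      using g hom_integer_frag_zero[of g "yb_basis m p"]
      by (simp add: yb_cochain_def Hom_group_def yb_chain_def)
    then have cobdry_0: "yb_coboundary m p g (frag_of xs) = 0" if "xs \<in> tuples m (Suc p)" for xs
      using that 0 by (simp add: yb_coboundary_def compose_def yb_boundary_def yb_chain_def
          yb_basis_Suc[OF m])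
    then have "z (frag_of xs) = 0" if "xs \<in> tuples m (Suc p)" for xs
      using pow[OF that, of k] that k zk_eq by simp
    then show ?thesis using g cobdry_0 by (intro bexI[of _ g]) auto
  next
    case (Suc q)
    have torsion: "int k * (z \<circ> frag_of) xs = left_sum m (Suc (Suc q)) (g \<circ> frag_of) xs
        - left_sum m (Suc (Suc q)) (g \<circ> frag_of) (shift m xs)" if "xs \<in> tuples m (Suc (Suc q))" for xs
      using yb_coboundary_frag_of[OF m, of g q xs] pow[of xs k] zk_eq g Suc that by simp
    have cocycle: "left_sum m (Suc (Suc (Suc q))) (z \<circ> frag_of) xs
        = left_sum m (Suc (Suc (Suc q))) (z \<circ> frag_of) (shift m xs)"
      if xs: "xs \<in> tuples m (Suc (Suc (Suc q)))" for xs
    proof -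
      have "yb_coboundary m (Suc p) z (frag_of xs) = \<one>\<^bsub>?C (Suc (Suc p))\<^esub> (frag_of xs)"
        using z by (simp add: yb_cocycles_def kernel_def)
      also have "\<dots> = 0"
        using xs Suc by (simp add: yb_cochain_def Hom_group_def yb_chain_def yb_basis_Suc[OF m])
      finally show ?thesis
        using yb_coboundary_frag_of[OF m z_carrier, of xs] xs Suc by simp
    qed
    obtain \<psi> where \<psi>: "\<And>xs. xs \<in> tuples m (Suc (Suc q)) \<Longrightarrow>
        int m * (z \<circ> frag_of) xs = left_sum m (Suc (Suc q)) \<psi> xs - left_sum m (Suc (Suc q)) \<psi> (shift m xs)"
      using torsion_left_sum[OF m k torsion cocycle] by blast
    \<comment> \<open>Freeness extends the bare function \<open>\<psi>\<close> to a homomorphism;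
      restricting it to the carrier then yields an extensional cochain.\<close>
    obtain h where h: "h \<in> hom (free_Abelian_group (tuples m p)) integer_group"
      and h_frag: "\<And>xs. xs \<in> tuples m p \<Longrightarrow> h (frag_of xs) = \<psi> xs"
      using comm_group.free_Abelian_group_universal[OF abelian_integer_group, of \<psi> "tuples m p"]
      by auto
    let ?h = "restrict h (carrier (yb_chain m p))"
    have chain: "yb_chain m p = free_Abelian_group (tuples m p)"
      using Suc by (simp add: yb_chain_def yb_basis_Suc[OF m])
    have hC: "?h \<in> carrier (?C p)"
      using h group.is_monoid[OF group_free_Abelian_group[of "tuples m p"]]
      unfolding yb_cochain_def Hom_group_def chain
      by (auto simp: hom_def Pi_iff monoid.m_closed simp del: mult_free_Abelian_group carrier_free_Abelian_group_iff)
    have "int m * z (frag_of xs) = yb_coboundary m p ?h (frag_of xs)" if xs: "xs \<in> tuples m (Suc p)" for xs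
    proof -
      \<comment> \<open>\<open>?h\<close> is known to agree with \<open>\<psi>\<close> on tuples of
        length \<open>p\<close>, and the left faces of \<open>ys\<close> are such tuples.\<close>
      have "left_sum m (Suc p) (?h \<circ> frag_of) ys = left_sum m (Suc p) \<psi> ys"
        if "ys \<in> tuples m (Suc p)" for ys
        using that by (intro left_sum_cong[OF m]) (auto simp: chain h_frag)
      then show ?thesis
        using yb_coboundary_frag_of[OF m, of ?h q xs] hC \<psi>[of xs] xs shift_tuples[OF m xs] Suc
        by simp
    qed
    then show ?thesis using hC by blast
  qed
  then obtain g where g: "g \<in> carrier (?C p)" and
    eq: "\<And>xs. xs \<in> tuples m (Suc p) \<Longrightarrow> int m * z (frag_of xs) = yb_coboundary m p g (frag_of xs)"
    by blast
  have "z [^]\<^bsub>?C (Suc p)\<^esub> m = yb_coboundary m p g"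
    using C.nat_pow_closed[OF z_carrier] cobdry_closed[OF g]
    by (rule yb_cochain_eqI[OF m]) (simp add: pow eq)
  then show ?thesis using g by (auto simp: yb_coboundaries_def)
qed

section \<open>The torsion bound in cohomology\<close>

theorem theorem3p17:
  fixes m n :: nat
  assumes "m \<ge> 1" and "n \<ge> 1"
  defines "H \<equiv> yb_cohomology m integer_group n"
  shows "(odd m \<longrightarrow> annihilated_by H (torsion_subgroup H) m) \<and>
         (even m \<longrightarrow> annihilated_by H (torsion_subgroup H) (2 * m))"
proof -
  let ?C = "yb_cochain m integer_group" and ?B = "yb_coboundaries m integer_group n"
    and ?Z = "yb_cocycles m integer_group n"
  obtain p where n: "n = Suc p" using \<open>n \<ge> 1\<close> by (cases n) auto
  interpret C: comm_group "?C n" by (rule comm_group_yb_cochain)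
  interpret \<delta>: group_hom "?C p" "?C n" "yb_coboundary m p"
    using yb_coboundary_hom[OF \<open>m \<ge> 1\<close>, of p integer_group] comm_group_yb_cochain[of m p]
      comm_group_yb_cochain[of m n]
    by (simp add: group_hom_def group_hom_axioms_def n comm_group_def)
  \<comment> \<open>In positive degree the coboundaries are the image of a homomorphism.\<close>
  have B: "subgroup ?B (?C n)"
    using \<delta>.img_is_subgroup by (simp add: yb_coboundaries_def n)
  have Z: "?Z \<subseteq> carrier (?C n)"
    by (auto simp: yb_cocycles_def kernel_def)
  have key: "z [^]\<^bsub>?C n\<^esub> m \<in> ?B" if "z \<in> ?Z" "k > 0" "z [^]\<^bsub>?C n\<^esub> k \<in> ?B" for z and k :: nat
    using torsion_yb_cocycle[OF \<open>m \<ge> 1\<close>] that unfolding n by blast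
  \<comment> \<open>The power \<open>2 * m\<close> of \<open>z\<close> is the square of its power
    \<open>m\<close>, which already lies in \<open>?B\<close>.\<close>
  have key2: "z [^]\<^bsub>?C n\<^esub> (2 * m) \<in> ?B" if "z \<in> ?Z" "k > 0" "z [^]\<^bsub>?C n\<^esub> k \<in> ?B" for z and k :: nat
    using subgroup.m_closed[OF B key[OF that] key[OF that]] that(1) Z
    by (auto simp: C.nat_pow_mult mult_2)
  have "annihilated_by H (torsion_subgroup H) m" "annihilated_by H (torsion_subgroup H) (2 * m)"
    unfolding H_def yb_cohomology_def
    by (rule C.annihilated_by_torsion_Mod[OF Z B], erule (2) key key2)+
  then show ?thesis by simp
qed

end
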